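(* Let $T_M$ be a Markov-Cayley tree. Every $m$-step tree-shift of finite type $\mathcal{T}\subseteq\mathcal{A}^{T_M}$ has the asymptotically $2^{-(m+1)}$-shadowing property.
   Context: **Trees.** Let $\Sigma=\{g_1,\dots,g_d\}$ be a finite set and $M$ a $d\times d$ matrix with entries in $\{0,1\}$ indexed by $\Sigma$. The Markov-Cayley tree $T_M$ is the set of finite words over $\Sigma$ consisting of the empty word $\epsilon$, all letters of $\Sigma$, and all words $g_{i_1}\cdots g_{i_n}$ ($n\ge2$) with $M(g_{i_j},g_{i_{j+1}})=1$ for all $1\le j\le n-1$. $T_M$ is assumed infinite. For a word $g$, $|g-\epsilon|$ is its length. The follower set of $g\in T_M$ is $F_{T_M}(g)=\{h\in T_M: gh\in T_M\}$ (concatenation). Let $\mathcal{I}=\{F_{T_M}(g):g\in T_M\}$ (a finite set). For $\eta\in\mathcal{I}$ put $T_M^{(\eta)}=\{g\in T_M:F_{T_M}(g)=\eta\}$ and $\Delta_m^{(\eta)}=\{g\in\eta:0\le|g-\epsilon|\le m\}$. **Tree-shifts.** Let $\mathcal{A}$ be a finite alphabet. For $t\in\mathcal{A}^{T_M}$ and $g\in T_M^{(\eta)}$, $\sigma_g(t)\in\mathcal{A}^{\eta}$ is given by $(\sigma_g(t))_{g'}=t_{gg'}$ for $g'\in\eta$. More generally, for $s\in\mathcal{A}^{\eta}$ and $g\in\eta$, $\sigma_g(s)$ is defined by $(\sigma_g(s))_{g'}=s_{gg'}$ for all $g'$ with $gg'\in\eta$. A tree-shift $\mathcal{T}$ on $T_M$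 is a set of the form $$\{t\in\mathcal{A}^{T_M}:\sigma_g(t)|_{\Delta_k^{(\eta)}}\notin\mathcal{F}\ \ \forall\eta\in\mathcal{I},\ \forall g\in T_M^{(\eta)},\ \forall k\ge0\}$$ for some $\mathcal{F}\subseteq\bigcup_{k\ge0}\bigcup_{\eta\in\mathcal{I}}\mathcal{A}^{\Delta_k^{(\eta)}}$. It is an $m$-step tree-shift of finite type ($m\ge0$ an integer) if $\mathcal{F}$ can be chosen with $\mathcal{F}\subseteq\bigcup_{\eta\in\mathcal{I}}\mathcal{A}^{\Delta_m^{(\eta)}}$. The projected tree-shift is $\mathcal{T}^{\mathcal{I}}=\bigsqcup_{\eta\in\mathcal{I}}\mathcal{T}^{(\eta)}$, with $\mathcal{T}^{(\eta)}=\bigcup_{g\in T_M^{(\eta)}}\{\sigma_g(t):t\in\mathcal{T}\}\subseteq\mathcal{A}^{\eta}$. **Distance.** For $s,t\in\mathcal{A}^{\eta}$, $d(s,t)=\inf\{2^{-k}: k\ge0 \text{ an integer},\ s|_{\Delta_k^{(\eta)}}=t|_{\Delta_k^{(\eta)}}\}$. Convention: $d(s,t)=2$ if $s$ and $t$ differ at $\epsilon$. **Asymptotic shadowing.** A projected orbit of $\mathcal{T}$ is a function $\mathcal{O}:T_M\to\mathcal{T}^{\mathcal{I}}$ with $\mathcal{O}(g)\in\mathcal{T}^{(\eta)}$ for all $g\in T_M^{(\eta)}$ and all $\eta\in\mathcal{I}$. For $\delta>0$, a projected orbit $\mathcal{O}$ is a $\delta$-projected pseudo orbit if $d(\sigma_{g_i}(\mathcal{O}(g)),\mathcal{O}(gg_i))<\delta$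 for all $g\in T_M$ and $g_i\in\Sigma$ with $gg_i\in T_M$. It is an asymptotically $\delta$-projected pseudo orbit if, in addition, for every $\delta'>0$ there is an integer $n$ such that $d(\sigma_{g_i}(\mathcal{O}(g)),\mathcal{O}(gg_i))<\delta'$ for all $g,gg_i\in T_M$ with $|g-\epsilon|>n$. $\mathcal{O}$ is asymptotically shadowed by $t\in\mathcal{T}$ if for all $\varepsilon>0$ there is $n\in\mathbb{N}$ such that $d(\sigma_g(t),\mathcal{O}(g))<\varepsilon$ for all $g\in T_M$ with $|g-\epsilon|>n$. $\mathcal{T}$ has the asymptotically $\delta$-shadowing property if every asymptotically $\delta$-projected pseudo orbit of $\mathcal{T}$ is asymptotically shadowed by a point of $\mathcal{T}$. *)

theory Defs
  imports "HOL-Analysis.Finite_Cartesian_Product"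
begin

text \<open>The set of letters is a finite type \<open>'g\<close>, the alphabet a finite type \<open>'a\<close>. Words are lists, and the
  length of a word is its distance to the root \<open>[]\<close>.\<close>

text \<open>\<open>successively\<close> holds vacuously for the empty word and for one-letter words.\<close>

definition mc_tree :: "nat ^ 'g ^ 'g \<Rightarrow> 'g list set" where
  "mc_tree M = {w. successively (\<lambda>a b. M $ a $ b = 1) w}"

definition follower :: "nat ^ 'g ^ 'g \<Rightarrow> 'g list \<Rightarrow> 'g list set" where
  "follower M g = {h \<in> mc_tree M. g @ h \<in> mc_tree M}"

definition follower_sets :: "nat ^ 'g ^ 'g \<Rightarrow> 'g list set set" where
  "follower_sets M = follower M ` mc_tree M"

definition nodes_of_type :: "nat ^ 'g ^ 'g \<Rightarrow> 'g list set \<Rightarrow> 'g list set" where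
  "nodes_of_type M \<eta> = {g \<in> mc_tree M. follower M g = \<eta>}"

definition initial_block :: "nat \<Rightarrow> 'g list set \<Rightarrow> 'g list set" where
  "initial_block m \<eta> = {g \<in> \<eta>. length g \<le> m}"

text \<open>Labellings of a set \<open>S\<close> of words are partial maps with domain exactly \<open>S\<close>. Thus labellings of
  different sets are different objects (which would fail for extensional total functions), and
  the union of the components of the projected tree-shift below is automatically disjoint.\<close>

definition labellings :: "'g list set \<Rightarrow> ('g list \<rightharpoonup> 'a) set" where
  "labellings S = {s. dom s = S}"

text \<open>The domain of \<open>shift g s\<close> consists of all \<open>g'\<close> with \<open>g @ g' \<in> dom s\<close>. If \<open>dom s\<close> is the tree
  and \<open>g\<close> a node of it, this is the follower set of \<open>g\<close>; see \<open>dom_shift\<close> below.\<close>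

definition shift :: "'g list \<Rightarrow> ('g list \<rightharpoonup> 'a) \<Rightarrow> ('g list \<rightharpoonup> 'a)" where
  "shift g s = (\<lambda>g'. s (g @ g'))"

lemma dom_shift:
  assumes "t \<in> labellings (mc_tree M)"
  shows "shift g t \<in> labellings (follower M g)"
proof -
  have "h \<in> mc_tree M" if "g @ h \<in> mc_tree M" for h
    using that by (simp add: mc_tree_def successively_append_iff)
  then have "follower M g = {h. g @ h \<in> mc_tree M}"
    unfolding follower_def by blast
  moreover have "dom (shift g t) = {h. g @ h \<in> dom t}"
    unfolding shift_def dom_def by simp
  ultimately show ?thesis
    using assms unfolding labellings_def by simp
qed

definition avoiding :: "nat ^ 'g ^ 'g \<Rightarrow> ('g list \<rightharpoonup> 'a) set \<Rightarrow> ('g list \<rightharpoonup> 'a) set" where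
  "avoiding M F = {t \<in> labellings (mc_tree M).
     \<forall>\<eta>\<in>follower_sets M. \<forall>g\<in>nodes_of_type M \<eta>. \<forall>k. shift g t |` initial_block k \<eta> \<notin> F}"

definition tree_shift :: "nat ^ 'g ^ 'g \<Rightarrow> ('g list \<rightharpoonup> 'a) set \<Rightarrow> bool" where
  "tree_shift M \<T> \<longleftrightarrow>
     (\<exists>F. F \<subseteq> (\<Union>k. \<Union>\<eta>\<in>follower_sets M. labellings (initial_block k \<eta>)) \<and> \<T> = avoiding M F)"

definition tree_shift_of_finite_type ::
    "nat ^ 'g ^ 'g \<Rightarrow> nat \<Rightarrow> ('g list \<rightharpoonup> 'a) set \<Rightarrow> bool" where
  "tree_shift_of_finite_type M m \<T> \<longleftrightarrow>
     (\<exists>F. F \<subseteq> (\<Union>\<eta>\<in>follower_sets M. labellings (initial_block m \<eta>)) \<and> \<T> = avoiding M F)"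

lemma tree_shift_of_finite_type_imp_tree_shift:
  assumes "tree_shift_of_finite_type M m \<T>"
  shows "tree_shift M \<T>"
proof -
  obtain F where F: "F \<subseteq> (\<Union>\<eta>\<in>follower_sets M. labellings (initial_block m \<eta>))"
    and T: "\<T> = avoiding M F"
    using assms unfolding tree_shift_of_finite_type_def by (elim exE conjE)
  have "F \<subseteq> (\<Union>k. \<Union>\<eta>\<in>follower_sets M. labellings (initial_block k \<eta>))"
    by (rule order_trans[OF F], rule UN_upper) (rule UNIV_I)
  with T show ?thesis unfolding tree_shift_def by (intro exI conjI)
qed

definition projected_component ::
    "nat ^ 'g ^ 'g \<Rightarrow> ('g list \<rightharpoonup> 'a) set \<Rightarrow> 'g list set \<Rightarrow> ('g list \<rightharpoonup> 'a) set" where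
  "projected_component M \<T> \<eta> = (\<Union>g\<in>nodes_of_type M \<eta>. {shift g t |t. t \<in> \<T>})"

definition projected_tree_shift ::
    "nat ^ 'g ^ 'g \<Rightarrow> ('g list \<rightharpoonup> 'a) set \<Rightarrow> ('g list \<rightharpoonup> 'a) set" where
  "projected_tree_shift M \<T> = (\<Union>\<eta>\<in>follower_sets M. projected_component M \<T> \<eta>)"

text \<open>The distance on labellings of \<open>\<eta>\<close>. The infimum is over the empty set exactly when the two
  labellings differ at the root, where the value is 2 by convention.\<close>

definition lab_dist :: "'g list set \<Rightarrow> ('g list \<rightharpoonup> 'a) \<Rightarrow> ('g list \<rightharpoonup> 'a) \<Rightarrow> real" where
  "lab_dist \<eta> s t =
     (if s [] \<noteq> t [] then 2
      else Inf {(1 / 2) ^ k |k. s |` initial_block k \<eta> = t |` initial_block k \<eta>})"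

text \<open>Orbits are functions on the tree; their values outside the tree are irrelevant.\<close>

definition projected_orbit ::
    "nat ^ 'g ^ 'g \<Rightarrow> ('g list \<rightharpoonup> 'a) set \<Rightarrow> ('g list \<Rightarrow> ('g list \<rightharpoonup> 'a)) \<Rightarrow> bool" where
  "projected_orbit M \<T> X \<longleftrightarrow>
     (\<forall>g\<in>mc_tree M. X g \<in> projected_tree_shift M \<T>) \<and>
     (\<forall>\<eta>\<in>follower_sets M. \<forall>g\<in>nodes_of_type M \<eta>. X g \<in> projected_component M \<T> \<eta>)"

definition pseudo_orbit ::
    "nat ^ 'g ^ 'g \<Rightarrow> real \<Rightarrow> ('g list \<rightharpoonup> 'a) set \<Rightarrow> ('g list \<Rightarrow> ('g list \<rightharpoonup> 'a)) \<Rightarrow> bool" where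
  "pseudo_orbit M \<delta> \<T> X \<longleftrightarrow> projected_orbit M \<T> X \<and>
     (\<forall>g\<in>mc_tree M. \<forall>a. g @ [a] \<in> mc_tree M \<longrightarrow>
        lab_dist (follower M (g @ [a])) (shift [a] (X g)) (X (g @ [a])) < \<delta>)"

definition asymptotic_pseudo_orbit ::
    "nat ^ 'g ^ 'g \<Rightarrow> real \<Rightarrow> ('g list \<rightharpoonup> 'a) set \<Rightarrow> ('g list \<Rightarrow> ('g list \<rightharpoonup> 'a)) \<Rightarrow> bool" where
  "asymptotic_pseudo_orbit M \<delta> \<T> X \<longleftrightarrow> pseudo_orbit M \<delta> \<T> X \<and>
     (\<forall>\<delta>'>0. \<exists>n. \<forall>g\<in>mc_tree M. \<forall>a. g @ [a] \<in> mc_tree M \<longrightarrow> length g > n \<longrightarrow>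
        lab_dist (follower M (g @ [a])) (shift [a] (X g)) (X (g @ [a])) < \<delta>')"

definition asymptotically_shadowed ::
    "nat ^ 'g ^ 'g \<Rightarrow> ('g list \<Rightarrow> ('g list \<rightharpoonup> 'a)) \<Rightarrow> ('g list \<rightharpoonup> 'a) \<Rightarrow> bool" where
  "asymptotically_shadowed M X t \<longleftrightarrow>
     (\<forall>\<epsilon>>0. \<exists>n. \<forall>g\<in>mc_tree M. length g > n \<longrightarrow> lab_dist (follower M g) (shift g t) (X g) < \<epsilon>)"

definition asymptotic_shadowing_property ::
    "nat ^ 'g ^ 'g \<Rightarrow> real \<Rightarrow> ('g list \<rightharpoonup> 'a) set \<Rightarrow> bool" where
  "asymptotic_shadowing_property M \<delta> \<T> \<longleftrightarrow>
     (\<forall>X. asymptotic_pseudo_orbit M \<delta> \<T> X \<longrightarrow> (\<exists>t\<in>\<T>. asymptotically_shadowed M X t))"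

end

theory Submission
  imports Defs
begin

text \<open>The shadowing point reads off the root labels of the orbit: \<open>t g = X g []\<close>. If consecutive
  entries of the orbit agree up to depth \<open>N\<close>, then following the edges of \<open>h\<close> gives
  \<open>X g h = X (g @ h) [] = t (g @ h)\<close> for \<open>length h \<le> Suc N\<close>. With \<open>N = m\<close> this makes every \<open>m\<close>-block
  of \<open>t\<close> a block of a point of \<open>\<T>\<close>, and with \<open>N\<close> arbitrary, far from the root, it gives
  asymptotic shadowing.\<close>

lemma mc_tree_appendD:
  assumes "g @ h \<in> mc_tree M"
  shows "g \<in> mc_tree M" "h \<in> mc_tree M"
  using assms by (auto simp: mc_tree_def successively_append_iff)

lemma mem_follower_iff: "h \<in> follower M g \<longleftrightarrow> g @ h \<in> mc_tree M"
  using mc_tree_appendD(2) by (auto simp: follower_def)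

text \<open>An infimum below \<open>(1 / 2) ^ k\<close> forces some agreement depth \<open>j\<close>
  with \<open>(1 / 2) ^ j < (1 / 2) ^ k\<close>, and such a \<open>j\<close> exceeds
  \<open>k\<close>.\<close>

lemma lab_dist_less_imp_eq:
  assumes less: "lab_dist \<eta> s t < (1 / 2) ^ k" and h: "h \<in> \<eta>" "length h \<le> k"
  shows "s h = t h"
proof -
  let ?A = "{(1 / 2 :: real) ^ k |k. s |` initial_block k \<eta> = t |` initial_block k \<eta>}"
  \<comment> \<open>The conventional value 2 at differing roots exceeds every power of 1/2.\<close>
  have root: "s [] = t []"
  proof (rule ccontr)
    assume "s [] \<noteq> t []"
    with less have "(2::real) < (1 / 2) ^ k" by (simp add: lab_dist_def)
    moreover have "(1 / 2 :: real) ^ k \<le> 1" by (rule power_le_one) auto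
    ultimately show False by linarith
  qed
  \<comment> \<open>Depth 0 is an agreement depth, so the infimum is over a nonempty set.\<close>
  then have "s |` initial_block 0 \<eta> = t |` initial_block 0 \<eta>"
    by (auto simp: initial_block_def restrict_map_def fun_eq_iff)
  then have "?A \<noteq> {}" by blast
  moreover have "Inf ?A < (1 / 2) ^ k" using less root by (simp add: lab_dist_def)
  ultimately have "\<exists>x\<in>?A. x < (1 / 2) ^ k" by (rule cInf_lessD)
  then obtain j where j: "(1 / 2 :: real) ^ j < (1 / 2) ^ k"
    and eq: "s |` initial_block j \<eta> = t |` initial_block j \<eta>"
    by (elim bexE CollectE exE conjE) (simp only:)
  have "k < j"
  proof (rule ccontr)
    assume "\<not> k < j"
    then have "(1 / 2 :: real) ^ k \<le> (1 / 2) ^ j" by (intro power_decreasing) auto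
    with j show False by linarith
  qed
  with h have "h \<in> initial_block j \<eta>" by (simp add: initial_block_def)
  with fun_cong[OF eq, of h] show ?thesis by simp
qed

text \<open>Agreement at the root is a separate premise because \<open>\<eta>\<close> is an
  arbitrary set here and may omit the empty word; it excludes the value 2.\<close>

lemma lab_dist_le:
  assumes "s [] = t []" and "\<And>h. h \<in> \<eta> \<Longrightarrow> length h \<le> k \<Longrightarrow> s h = t h"
  shows "lab_dist \<eta> s t \<le> (1 / 2) ^ k"
proof -
  have "s |` initial_block k \<eta> = t |` initial_block k \<eta>"
    using assms(2) by (auto simp: initial_block_def restrict_map_def)
  then have "Inf {(1 / 2 :: real) ^ k |k. s |` initial_block k \<eta> = t |` initial_block k \<eta>}
      \<le> (1 / 2) ^ k"
    by (intro cInf_lower bdd_belowI[of _ 0]) auto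
  with assms(1) show ?thesis by (simp add: lab_dist_def)
qed

text \<open>Induction on \<open>h\<close> with moving base node: the first letter \<open>a\<close>
  is absorbed by passing from \<open>X g\<close> to \<open>X (g @ [a])\<close>. The rest has length
  at most \<open>N\<close>, where the two entries agree; hence the bound \<open>Suc N\<close>. Depth
  only grows along the path, so closeness from depth \<open>n\<close> on suffices.\<close>

lemma orbit_eq_root_label:
  assumes close: "\<And>g a. g @ [a] \<in> mc_tree M \<Longrightarrow> n \<le> length g \<Longrightarrow>
      lab_dist (follower M (g @ [a])) (shift [a] (X g)) (X (g @ [a])) < (1 / 2) ^ N"
    and "g @ h \<in> mc_tree M" and "n \<le> length g" and "length h \<le> Suc N"
  shows "X g h = X (g @ h) []"
  using assms(2-)
proof (induction h arbitrary: g)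
  case Nil
  then show ?case by simp
next
  case (Cons a h)
  have mem: "(g @ [a]) @ h \<in> mc_tree M" using Cons.prems(1) by simp
  have "shift [a] (X g) h = X (g @ [a]) h"
  proof (rule lab_dist_less_imp_eq)
    show "lab_dist (follower M (g @ [a])) (shift [a] (X g)) (X (g @ [a])) < (1 / 2) ^ N"
      using close[OF mc_tree_appendD(1)[OF mem]] Cons.prems(2) by blast
    show "h \<in> follower M (g @ [a])" using mem by (simp only: mem_follower_iff)
    show "length h \<le> N" using Cons.prems(3) by simp
  qed
  moreover have "X (g @ [a]) h = X ((g @ [a]) @ h) []"
    using mem Cons.prems by (intro Cons.IH) auto
  ultimately show ?case by (simp add: shift_def)
qed

text \<open>Membership in \<open>avoiding M F\<close> involves blocks of every size \<open>k\<close>. For \<open>k > m\<close> such a block can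
  lie in \<open>F\<close> only if the follower set contains no words of length between \<open>m + 1\<close> and \<open>k\<close>, so that
  the block has size \<open>m\<close> after all.\<close>

lemma avoiding_of_local_agreement:
  assumes F: "F \<subseteq> (\<Union>\<eta>\<in>follower_sets M. labellings (initial_block m \<eta>))"
    and t: "t \<in> labellings (mc_tree M)"
    and loc: "\<And>g. g \<in> mc_tree M \<Longrightarrow> \<exists>s\<in>projected_component M (avoiding M F) (follower M g).
      \<forall>h\<in>follower M g. length h \<le> m \<longrightarrow> shift g t h = s h"
  shows "t \<in> avoiding M F"
  unfolding avoiding_def
proof (intro CollectI conjI ballI allI t)
  fix \<eta> g k
  assume g: "g \<in> nodes_of_type M \<eta>"
  then have gM: "g \<in> mc_tree M" and \<eta>: "follower M g = \<eta>"
    by (auto simp: nodes_of_type_def)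
  obtain s where "s \<in> projected_component M (avoiding M F) \<eta>"
    and eq: "\<And>h. h \<in> \<eta> \<Longrightarrow> length h \<le> m \<Longrightarrow> shift g t h = s h"
    using loc[OF gM] \<eta> by blast
  \<comment> \<open>The node \<open>g'\<close> may differ from \<open>g\<close>, but it has the same
    type, so the constraint on \<open>t'\<close> at \<open>g'\<close> concerns blocks of the same
    shape.\<close>
  then obtain g' t' where g': "g' \<in> nodes_of_type M \<eta>" and t': "t' \<in> avoiding M F"
    and s: "s = shift g' t'"
    by (auto simp: projected_component_def)
  have "\<eta> \<in> follower_sets M" using gM \<eta> by (auto simp: follower_sets_def)
  then have allowed: "s |` initial_block k \<eta> \<notin> F"
    using t' g' s by (auto simp: avoiding_def)
  show "shift g t |` initial_block k \<eta> \<notin> F"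
  proof
    assume bad: "shift g t |` initial_block k \<eta> \<in> F"
    then obtain \<eta>' where "dom (shift g t |` initial_block k \<eta>) = initial_block m \<eta>'"
      using F by (fastforce simp: labellings_def)
    moreover have "dom (shift g t) = \<eta>"
      using dom_shift[OF t, of g] \<eta> by (simp add: labellings_def)
    ultimately have "initial_block k \<eta> = initial_block m \<eta>'"
      by (auto simp: initial_block_def)
    then have "shift g t h = s h" if "h \<in> initial_block k \<eta>" for h
      using that eq by (auto simp: initial_block_def)
    then have "shift g t |` initial_block k \<eta> = s |` initial_block k \<eta>"
      by (auto simp: restrict_map_def)
    with bad allowed show False by simp
  qed
qed

theorem theorem1p14:
  fixes M :: "nat ^ 'g::finite ^ 'g" and m :: nat and \<T> :: "('g list \<rightharpoonup> 'a::finite) set"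
  assumes "\<forall>a b. M $ a $ b \<in> {0, 1}"
    and "infinite (mc_tree M)"
    and "tree_shift_of_finite_type M m \<T>"
  shows "asymptotic_shadowing_property M ((1 / 2) ^ (m + 1)) \<T>"
  unfolding asymptotic_shadowing_property_def
proof (intro allI impI)
  fix X
  assume X: "asymptotic_pseudo_orbit M ((1 / 2) ^ (m + 1)) \<T> X"
  obtain F where F: "F \<subseteq> (\<Union>\<eta>\<in>follower_sets M. labellings (initial_block m \<eta>))"
    and T: "\<T> = avoiding M F"
    using assms(3) by (auto simp: tree_shift_of_finite_type_def)
  \<comment> \<open>The value \<open>None\<close> off the tree makes the domain of \<open>t\<close>
    exactly the tree.\<close>
  define t where "t = (\<lambda>g. if g \<in> mc_tree M then X g [] else None)"
  have comp: "X g \<in> projected_component M \<T> (follower M g)" if "g \<in> mc_tree M" for g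
    using X that by (auto simp: asymptotic_pseudo_orbit_def pseudo_orbit_def projected_orbit_def
        nodes_of_type_def follower_sets_def)
  have "X g [] \<noteq> None" if g: "g \<in> mc_tree M" for g
  proof -
    \<comment> \<open>\<open>X g\<close> is a shift of a point of \<open>\<T>\<close> at a node of
      the same type as \<open>g\<close>, so its domain is the follower set of \<open>g\<close>,
      which contains the root.\<close>
    obtain g' t' where "follower M g' = follower M g" "X g = shift g' t'" "t' \<in> \<T>"
      using comp[OF g] by (auto simp: projected_component_def nodes_of_type_def)
    then have "dom (X g) = follower M g"
      using dom_shift[of t' M g'] by (simp add: T avoiding_def labellings_def)
    moreover have "[] \<in> follower M g" using g by (simp add: mem_follower_iff)
    ultimately show ?thesis by blast
  qed
  then have t: "t \<in> labellings (mc_tree M)"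
    by (auto simp: labellings_def t_def split: if_splits)
  have step: "lab_dist (follower M (g @ [a])) (shift [a] (X g)) (X (g @ [a])) < (1 / 2) ^ (m + 1)"
    if "g @ [a] \<in> mc_tree M" for g a
    using X that mc_tree_appendD(1)[OF that]
    by (auto simp: asymptotic_pseudo_orbit_def pseudo_orbit_def)
  have "shift g t h = X g h" if "h \<in> follower M g" "length h \<le> m" for g h
  proof -
    have "g @ h \<in> mc_tree M" using that by (simp add: mem_follower_iff)
    moreover from this have "X g h = X (g @ h) []"
      \<comment> \<open>Here \<open>n = 0\<close> because the pseudo orbit bound holds at every
        node, and \<open>N = m + 1\<close> is its exponent.\<close>
      using that(2) by (intro orbit_eq_root_label[where n = 0 and N = "m + 1", OF step]) auto
    ultimately show ?thesis by (simp add: shift_def t_def)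
  qed
  then have "t \<in> \<T>"
    \<comment> \<open>The required local model of \<open>t\<close> at \<open>g\<close> is
      \<open>X g\<close> itself.\<close>
    unfolding T using comp by (intro avoiding_of_local_agreement[OF F t]) (auto simp: T)
  moreover have "asymptotically_shadowed M X t"
    unfolding asymptotically_shadowed_def
  proof (intro allI impI)
    fix \<epsilon> :: real
    assume "\<epsilon> > 0"
    \<comment> \<open>The same \<open>N\<close> serves as target precision and, through
      \<open>(1 / 2) ^ N\<close>, as the tolerance demanded of the orbit far from the root.\<close>
    then obtain N where N: "(1 / 2) ^ N < \<epsilon>"
      using real_arch_pow_inv[of \<epsilon> "1 / 2"] by auto
    have "\<forall>\<delta>>0. \<exists>n. \<forall>g\<in>mc_tree M. \<forall>a. g @ [a] \<in> mc_tree M \<longrightarrow> length g > n \<longrightarrow>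
        lab_dist (follower M (g @ [a])) (shift [a] (X g)) (X (g @ [a])) < \<delta>"
      using X by (simp add: asymptotic_pseudo_orbit_def)
    then obtain n where "\<forall>g\<in>mc_tree M. \<forall>a. g @ [a] \<in> mc_tree M \<longrightarrow> length g > n \<longrightarrow>
        lab_dist (follower M (g @ [a])) (shift [a] (X g)) (X (g @ [a])) < (1 / 2) ^ N"
      by (meson zero_less_power half_gt_zero zero_less_one)
    then have n: "\<And>g a. g @ [a] \<in> mc_tree M \<Longrightarrow> Suc n \<le> length g \<Longrightarrow>
        lab_dist (follower M (g @ [a])) (shift [a] (X g)) (X (g @ [a])) < (1 / 2) ^ N"
      using mc_tree_appendD(1) by (metis Suc_le_eq)
    have "lab_dist (follower M g) (shift g t) (X g) \<le> (1 / 2) ^ N"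
      if g: "g \<in> mc_tree M" "n < length g" for g
    proof (rule lab_dist_le)
      show "shift g t [] = X g []" using g by (simp add: shift_def t_def)
      show "shift g t h = X g h" if "h \<in> follower M g" "length h \<le> N" for h
      proof -
        have "g @ h \<in> mc_tree M" using that by (simp add: mem_follower_iff)
        moreover from this have "X g h = X (g @ h) []"
          \<comment> \<open>Every node on the path from \<open>g\<close> to \<open>g @ h\<close> is
            at least as deep as \<open>g\<close>, so the closeness bound applies along the whole
            path.\<close>
          using that(2) g(2) by (intro orbit_eq_root_label[OF n]) auto
        ultimately show ?thesis by (simp add: shift_def t_def)
      qed
    qed
    with N show "\<exists>n. \<forall>g\<in>mc_tree M. length g > n \<longrightarrow>
        lab_dist (follower M g) (shift g t) (X g) < \<epsilon>"
      by (meson le_less_trans)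
  qed
  ultimately show "\<exists>t\<in>\<T>. asymptotically_shadowed M X t" by blast
qed

end
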